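(* Let $(\Omega,\mu)$ be a measure space with $\mu$ a continuous measure (i.e., without point masses). I. There exists a sequence $(v_n)_{n\ge1}$ in $L^2_{\mathbb R}(\Omega,\mu)$ such that (1) $v_n\ge 0$ on $\Omega$ for all $n$; (2) $\sum_n v_n(x)^2=\infty$ on $\Omega$; (3) there is $B>0$ such that $0<\sum_n|(f,v_n)|^2\le B\|f\|^2$ for every $f\in L^2_{\mathbb R}(\Omega,\mu)$, $f\neq0$ (i.e., $(v_n)$ is a complete Bessel sequence). II. There exist a subset $E\subset\Omega$ with $0<\mu E<\infty$ and an orthonormal basis $(u_k)_{k\ge1}$ of $L^2_{\mathbb R}(\Omega,\mu)$ such that the functions $v_n:=u_{2n}|_E$, $n=1,2,\dots$, satisfy conditions (1)–(3) of part I with $\Omega$ replaced by $E$ (and $L^2_{\mathbb R}(\Omega,\mu)$ replaced by $L^2_{\mathbb R}(E,\mu)$).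
   Context: $L^2_{\mathbb R}(\Omega,\mu)$ denotes the real Lebesgue space with inner product $(f,g)=\int_\Omega fg\,d\mu$.
   Formalization: Adds that L² is separable and μ σ-finite, reads "continuous" as: every set of positive measure has a subset of strictly smaller positive measure (all needed for part I to hold); part II assumes μΩ>0; conditions (1) and (2) are meant almost everywhere. *)

theory Defs
  imports "HOL-Analysis.Analysis"
begin

definition L2 :: "'a measure \<Rightarrow> ('a \<Rightarrow> real) set" where
  "L2 M = {f \<in> borel_measurable M. integrable M (\<lambda>x. (f x)\<^sup>2)}"

definition l2_inner :: "'a measure \<Rightarrow> ('a \<Rightarrow> real) \<Rightarrow> ('a \<Rightarrow> real) \<Rightarrow> real" where
  "l2_inner M f g = (\<integral>x. f x * g x \<partial>M)"

definition continuous_measure :: "'a measure \<Rightarrow> bool" where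
  "continuous_measure M \<longleftrightarrow>
     (\<forall>A\<in>sets M. 0 < emeasure M A \<longrightarrow>
        (\<exists>B\<in>sets M. B \<subseteq> A \<and> 0 < emeasure M B \<and> emeasure M B < emeasure M A))"

definition L2_separable :: "'a measure \<Rightarrow> bool" where
  "L2_separable M \<longleftrightarrow>
     (\<exists>D :: nat \<Rightarrow> 'a \<Rightarrow> real. (\<forall>n. D n \<in> L2 M) \<and>
        (\<forall>f\<in>L2 M. \<forall>e>0. \<exists>n. l2_inner M (\<lambda>x. f x - D n x) (\<lambda>x. f x - D n x) < e))"

definition orthonormal_basis :: "'a measure \<Rightarrow> (nat \<Rightarrow> 'a \<Rightarrow> real) \<Rightarrow> bool" where
  "orthonormal_basis M u \<longleftrightarrow>
     (\<forall>k. u k \<in> L2 M) \<and>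
     (\<forall>j k. l2_inner M (u j) (u k) = (if j = k then 1 else 0)) \<and>
     (\<forall>f\<in>L2 M. (\<forall>k. l2_inner M f (u k) = 0) \<longrightarrow> (AE x in M. f x = 0))"

definition complete_bessel :: "'a measure \<Rightarrow> (nat \<Rightarrow> 'a \<Rightarrow> real) \<Rightarrow> bool" where
  "complete_bessel M v \<longleftrightarrow>
     (\<forall>n. v n \<in> L2 M) \<and>
     (\<exists>B>0. \<forall>f\<in>L2 M. \<not> (AE x in M. f x = 0) \<longrightarrow>
        summable (\<lambda>n. \<bar>l2_inner M f (v n)\<bar>\<^sup>2) \<and>
        0 < (\<Sum>n. \<bar>l2_inner M f (v n)\<bar>\<^sup>2) \<and>
        (\<Sum>n. \<bar>l2_inner M f (v n)\<bar>\<^sup>2) \<le> B * l2_inner M f f)"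

definition conditions_123 :: "'a measure \<Rightarrow> (nat \<Rightarrow> 'a \<Rightarrow> real) \<Rightarrow> bool" where
  "conditions_123 M v \<longleftrightarrow>
     (\<forall>n. v n \<in> L2 M) \<and>
     (AE x in M. \<forall>n. 0 \<le> v n x) \<and>
     (AE x in M. (\<Sum>n. ennreal ((v n x)\<^sup>2)) = \<infinity>) \<and>
     complete_bessel M v"

end

theory Submission
  imports Defs
begin

text \<open>
  For part I, cover the space for each \<open>k\<close> by countably many disjoint sets \<open>Q k j\<close> of measure at most
  \<open>1/2^k\<close>. Their indicators have Bessel bound \<open>1/2^k\<close> while their squares sum to 1 almost everywhere,
  so all of them together form a Bessel sequence whose squares sum to \<open>\<infinity>\<close>; adding small multiples of
  the positive and negative parts of a dense sequence makes it complete.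

  For part II, let \<open>v\<close> be such a sequence on \<open>E\<close>, scaled to Bessel bound 1, so that the identity minus its
  Gram matrix is positive semidefinite and has a Cholesky factorisation \<open>L L\<^sup>T\<close>. With orthonormal
  functions \<open>e k\<close> supported off \<open>E\<close>, the functions \<open>v n + (\<Sum>k\<le>n. L n k * e k)\<close> are orthonormal and restrict
  to \<open>v n\<close> on \<open>E\<close>. Zorn's lemma extends them to a maximal orthonormal set, which is a basis and is
  countable by separability; orthonormal functions orthogonal to the construction are set aside
  beforehand so that infinitely many basis elements remain for the other parity.
\<close>

section \<open>The space of square-integrable functions\<close>

lemma L2_measurable: "f \<in> L2 M \<Longrightarrow> f \<in> borel_measurable M"
  and L2_integrable_square: "f \<in> L2 M \<Longrightarrow> integrable M (\<lambda>x. (f x)\<^sup>2)"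
  by (auto simp: L2_def)

lemma L2_I:
  assumes "f \<in> borel_measurable M" "integrable M (\<lambda>x. (f x)\<^sup>2)"
  shows "f \<in> L2 M"
  using assms by (simp add: L2_def)

lemma L2_dominated:
  assumes "g \<in> L2 M" "f \<in> borel_measurable M" "\<And>x. x \<in> space M \<Longrightarrow> \<bar>f x\<bar> \<le> \<bar>g x\<bar>"
  shows "f \<in> L2 M"
proof (rule L2_I)
  show "integrable M (\<lambda>x. (f x)\<^sup>2)"
    by (rule Bochner_Integration.integrable_bound[OF L2_integrable_square[OF assms(1)]])
      (use assms in \<open>auto intro!: AE_I2 simp: abs_le_square_iff\<close>)
qed fact

lemma L2_mult_integrable:
  assumes "f \<in> L2 M" "g \<in> L2 M"
  shows "integrable M (\<lambda>x. f x * g x)"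
proof (rule Bochner_Integration.integrable_bound)
  show "integrable M (\<lambda>x. (f x)\<^sup>2 + (g x)\<^sup>2)"
    using assms by (simp add: L2_integrable_square)
  show "AE x in M. norm (f x * g x) \<le> norm ((f x)\<^sup>2 + (g x)\<^sup>2)"
  proof (rule AE_I2)
    fix x
    have "2 * (\<bar>f x\<bar> * \<bar>g x\<bar>) \<le> (f x)\<^sup>2 + (g x)\<^sup>2"
      using sum_squares_bound[of "\<bar>f x\<bar>" "\<bar>g x\<bar>"] by simp
    moreover have "0 \<le> \<bar>f x\<bar> * \<bar>g x\<bar>" by simp
    ultimately have "\<bar>f x\<bar> * \<bar>g x\<bar> \<le> (f x)\<^sup>2 + (g x)\<^sup>2" by linarith
    then show "norm (f x * g x) \<le> norm ((f x)\<^sup>2 + (g x)\<^sup>2)"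
      by (simp add: abs_mult)
  qed
qed (intro borel_measurable_times L2_measurable assms)

lemma L2_scale [intro]: "f \<in> L2 M \<Longrightarrow> (\<lambda>x. c * f x) \<in> L2 M"
  by (auto simp: L2_def power_mult_distrib)

lemma L2_add [intro]:
  assumes "f \<in> L2 M" "g \<in> L2 M"
  shows "(\<lambda>x. f x + g x) \<in> L2 M"
proof (rule L2_I)
  have "integrable M (\<lambda>x. (f x)\<^sup>2 + (g x)\<^sup>2 + 2 * (f x * g x))"
    using assms by (simp add: L2_integrable_square L2_mult_integrable)
  then show "integrable M (\<lambda>x. (f x + g x)\<^sup>2)"
    by (simp add: power2_sum mult.assoc)
qed (intro borel_measurable_add L2_measurable assms)

lemma L2_diff [intro]: "f \<in> L2 M \<Longrightarrow> g \<in> L2 M \<Longrightarrow> (\<lambda>x. f x - g x) \<in> L2 M"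
  using L2_add[OF _ L2_scale[of g M "-1"], of f] by simp

lemma L2_sum [intro]:
  assumes "\<And>i. i \<in> S \<Longrightarrow> f i \<in> L2 M"
  shows "(\<lambda>x. \<Sum>i\<in>S. f i x) \<in> L2 M"
  using assms
proof (induction S rule: infinite_finite_induct)
  case (insert i S)
  then show ?case by (simp add: L2_add)
qed (simp_all add: L2_def)

lemma L2_indicator [intro]:
  assumes "A \<in> sets M" "emeasure M A < \<infinity>"
  shows "indicator A \<in> L2 M"
  using assms by (simp add: L2_def power2_eq_square flip: indicator_inter_arith)

section \<open>The inner product and the Cauchy-Schwarz inequality\<close>

lemma l2_inner_commute: "l2_inner M f g = l2_inner M g f"
  by (simp add: l2_inner_def mult.commute)

lemma l2_inner_add_left:
  assumes "f \<in> L2 M" "g \<in> L2 M" "h \<in> L2 M"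
  shows "l2_inner M (\<lambda>x. f x + g x) h = l2_inner M f h + l2_inner M g h"
  using assms by (simp add: l2_inner_def distrib_right L2_mult_integrable)

lemma l2_inner_diff_left:
  assumes "f \<in> L2 M" "g \<in> L2 M" "h \<in> L2 M"
  shows "l2_inner M (\<lambda>x. f x - g x) h = l2_inner M f h - l2_inner M g h"
  using assms by (simp add: l2_inner_def left_diff_distrib L2_mult_integrable)

lemma l2_inner_scale_left: "l2_inner M (\<lambda>x. c * f x) h = c * l2_inner M f h"
  by (simp add: l2_inner_def mult.assoc)

lemma l2_inner_sum_left:
  assumes "\<And>i. i \<in> S \<Longrightarrow> f i \<in> L2 M" "h \<in> L2 M"
  shows "l2_inner M (\<lambda>x. \<Sum>i\<in>S. f i x) h = (\<Sum>i\<in>S. l2_inner M (f i) h)"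
  using assms by (simp add: l2_inner_def sum_distrib_right L2_mult_integrable)

lemma l2_inner_add_right:
  assumes "f \<in> L2 M" "g \<in> L2 M" "h \<in> L2 M"
  shows "l2_inner M h (\<lambda>x. f x + g x) = l2_inner M h f + l2_inner M h g"
  using l2_inner_add_left[OF assms] by (simp add: l2_inner_commute)

lemma l2_inner_diff_right:
  assumes "f \<in> L2 M" "g \<in> L2 M" "h \<in> L2 M"
  shows "l2_inner M h (\<lambda>x. f x - g x) = l2_inner M h f - l2_inner M h g"
  using l2_inner_diff_left[OF assms] by (simp add: l2_inner_commute)

lemma l2_inner_scale_right: "l2_inner M h (\<lambda>x. c * f x) = c * l2_inner M h f"
  using l2_inner_scale_left[of M c f h] by (simp add: l2_inner_commute)

lemma l2_inner_sum_right:
  assumes "\<And>i. i \<in> S \<Longrightarrow> f i \<in> L2 M" "h \<in> L2 M"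
  shows "l2_inner M h (\<lambda>x. \<Sum>i\<in>S. f i x) = (\<Sum>i\<in>S. l2_inner M h (f i))"
  using l2_inner_sum_left[OF assms] by (simp add: l2_inner_commute)

lemma l2_inner_nonneg: "0 \<le> l2_inner M f f"
  by (simp add: l2_inner_def)

lemma l2_inner_self_eq_0_iff:
  assumes "f \<in> L2 M"
  shows "l2_inner M f f = 0 \<longleftrightarrow> (AE x in M. f x = 0)"
  using integral_nonneg_eq_0_iff_AE[OF L2_integrable_square[OF assms]]
  by (simp add: l2_inner_def power2_eq_square)

lemma l2_inner_AE_zero:
  assumes "AE x in M. f x = 0"
  shows "l2_inner M f g = 0"
proof -
  have "AE x in M. f x * g x = 0" using assms by eventually_elim simp
  then show ?thesis unfolding l2_inner_def by (rule integral_eq_zero_AE)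
qed

lemma l2_inner_cong:
  assumes "\<And>x. x \<in> space M \<Longrightarrow> f x = f' x" "\<And>x. x \<in> space M \<Longrightarrow> g x = g' x"
  shows "l2_inner M f g = l2_inner M f' g'"
  unfolding l2_inner_def using assms by (intro Bochner_Integration.integral_cong) auto

lemma L2_cong:
  assumes "\<And>x. x \<in> space M \<Longrightarrow> f x = g x"
  shows "f \<in> L2 M \<longleftrightarrow> g \<in> L2 M"
  unfolding L2_def using assms
  by (simp cong: measurable_cong Bochner_Integration.integrable_cong)

lemma l2_cauchy_schwarz:
  assumes f: "f \<in> L2 M" and g: "g \<in> L2 M"
  shows "(l2_inner M f g)\<^sup>2 \<le> l2_inner M f f * l2_inner M g g"
proof (cases "l2_inner M g g = 0")
  case True
  then have "l2_inner M g f = 0"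
    using l2_inner_self_eq_0_iff[OF g] l2_inner_AE_zero by blast
  then show ?thesis by (simp add: l2_inner_commute[of M f g] True)
next
  case False
  then have pos: "0 < l2_inner M g g" using l2_inner_nonneg[of M g] by linarith
  \<comment> \<open>\<open>t * g\<close> is the orthogonal projection of \<open>f\<close> onto the
    line spanned by \<open>g\<close>, so this \<open>t\<close> minimises the norm of
    \<open>f - t * g\<close> and yields the sharp inequality.\<close>
  define t where "t = l2_inner M f g / l2_inner M g g"
  have "0 \<le> l2_inner M (\<lambda>x. f x - t * g x) (\<lambda>x. f x - t * g x)" by (rule l2_inner_nonneg)
  also have "\<dots> = l2_inner M f f - 2 * t * l2_inner M f g + t\<^sup>2 * l2_inner M g g"
    using f g by (simp add: l2_inner_diff_left l2_inner_diff_right l2_inner_scale_left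
        l2_inner_scale_right L2_scale L2_diff l2_inner_commute[of M g f] algebra_simps power2_eq_square)
  also have "\<dots> = l2_inner M f f - (l2_inner M f g)\<^sup>2 / l2_inner M g g"
    using pos by (simp add: t_def field_simps power2_eq_square)
  finally show ?thesis using pos by (simp add: field_simps)
qed

lemma l2_inner_indicator:
  assumes "A \<in> sets M" "B \<in> sets M"
  shows "l2_inner M (indicator A) (indicator B) = measure M (A \<inter> B)"
  using assms by (simp add: l2_inner_def flip: indicator_inter_arith)

text \<open>A set rather than a sequence, so that inclusion orders the candidates for Zorn's lemma.
  Members are functions and not classes; two members that agree almost everywhere would have inner
  product 1 and hence are the same function.\<close>

definition orthonormal_set :: "'a measure \<Rightarrow> ('a \<Rightarrow> real) set \<Rightarrow> bool" where
  "orthonormal_set M S \<longleftrightarrow>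
     S \<subseteq> L2 M \<and> (\<forall>f\<in>S. \<forall>g\<in>S. l2_inner M f g = (if f = g then 1 else 0))"

text \<open>Distinct members have squared distance 2, so no element of a dense sequence
  is within squared distance \<open>1/2\<close> of two of them.\<close>
lemma countable_orthonormal_set:
  assumes sep: "L2_separable M" and S: "orthonormal_set M S"
  shows "countable S"
proof -
  obtain D :: "nat \<Rightarrow> 'a \<Rightarrow> real" where D: "\<And>n. D n \<in> L2 M"
    and dense: "\<And>f e. f \<in> L2 M \<Longrightarrow> e > 0 \<Longrightarrow> \<exists>n. l2_inner M (\<lambda>x. f x - D n x) (\<lambda>x. f x - D n x) < e"
    using sep unfolding L2_separable_def by blast
  have SL: "\<And>f. f \<in> S \<Longrightarrow> f \<in> L2 M" using S by (auto simp: orthonormal_set_def)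
  define N where "N f = (SOME n. l2_inner M (\<lambda>x. f x - D n x) (\<lambda>x. f x - D n x) < 1/2)" for f
  have N: "l2_inner M (\<lambda>x. f x - D (N f) x) (\<lambda>x. f x - D (N f) x) < 1/2" if "f \<in> S" for f
    unfolding N_def by (rule someI_ex) (rule dense[OF SL[OF that]], simp)
  have "inj_on N S"
  proof (rule inj_onI, rule ccontr)
    fix f g assume f: "f \<in> S" and g: "g \<in> S" and eq: "N f = N g" and ne: "f \<noteq> g"
    define p where "p x = f x - D (N f) x" for x
    define q where "q x = g x - D (N f) x" for x
    have p: "p \<in> L2 M" and q: "q \<in> L2 M"
      unfolding p_def q_def using SL[OF f] SL[OF g] D by (auto intro: L2_diff)
    have pq: "l2_inner M p p < 1/2" "l2_inner M q q < 1/2"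
      using N[OF f] N[OF g] eq by (simp_all add: p_def[abs_def] q_def[abs_def])
    have "2 = l2_inner M (\<lambda>x. f x - g x) (\<lambda>x. f x - g x)"
      using S f g ne by (auto simp: l2_inner_diff_left l2_inner_diff_right L2_diff SL orthonormal_set_def)
    also have "\<dots> = l2_inner M (\<lambda>x. p x - q x) (\<lambda>x. p x - q x)"
      by (simp add: p_def q_def)
    \<comment> \<open>Parallelogram law for \<open>p\<close> and \<open>q\<close>; the radius
      \<open>1/2\<close> is what makes the right-hand side stay below 2.\<close>
    also have "\<dots> = 2 * l2_inner M p p + 2 * l2_inner M q q - l2_inner M (\<lambda>x. p x + q x) (\<lambda>x. p x + q x)"
      using p q by (simp add: l2_inner_diff_left l2_inner_diff_right L2_diff l2_inner_add_left
          l2_inner_add_right L2_add l2_inner_commute[of M q p])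
    also have "\<dots> < 2"
      using pq l2_inner_nonneg[of M "\<lambda>x. p x + q x"] by linarith
    finally show False by simp
  qed
  then show ?thesis by (metis countableI)
qed

text \<open>Take a maximal orthonormal set above \<open>C\<close>. If a function that is not almost
  everywhere zero were orthogonal to all of it, its normalisation could be adjoined, against
  maximality.\<close>

lemma orthonormal_set_extend:
  assumes C: "orthonormal_set M C"
  obtains S where "C \<subseteq> S" "orthonormal_set M S"
    "\<And>f. f \<in> L2 M \<Longrightarrow> (\<And>g. g \<in> S \<Longrightarrow> l2_inner M f g = 0) \<Longrightarrow> AE x in M. f x = 0"
proof -
  define \<A> where "\<A> = {S. C \<subseteq> S \<and> orthonormal_set M S}"
  have "\<exists>S\<in>\<A>. \<forall>X\<in>\<A>. S \<subseteq> X \<longrightarrow> X = S"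
  proof (rule subset_Zorn_nonempty)
    show "\<A> \<noteq> {}" using C by (auto simp: \<A>_def)
    fix \<C> assume ne: "\<C> \<noteq> {}" and ch: "subset.chain \<A> \<C>"
    have \<C>: "\<And>X. X \<in> \<C> \<Longrightarrow> C \<subseteq> X \<and> orthonormal_set M X"
      using ch by (auto simp: subset_chain_def \<A>_def)
    have "l2_inner M f g = (if f = g then 1 else 0)" if "f \<in> \<Union>\<C>" "g \<in> \<Union>\<C>" for f g
    proof -
      from that obtain X Y where XY: "X \<in> \<C>" "f \<in> X" "Y \<in> \<C>" "g \<in> Y" by blast
      then have "X \<subseteq> Y \<or> Y \<subseteq> X" using ch by (auto simp: subset_chain_def)
      with XY obtain X where "X \<in> \<C>" "f \<in> X" "g \<in> X" by blast
      then show ?thesis using \<C>[of X] by (auto simp: orthonormal_set_def)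
    qed
    moreover have "C \<subseteq> \<Union>\<C>" using \<C> ne by blast
    moreover have "\<Union>\<C> \<subseteq> L2 M" using \<C> unfolding orthonormal_set_def by blast
    ultimately show "\<Union>\<C> \<in> \<A>"
      unfolding \<A>_def orthonormal_set_def by simp
  qed
  then obtain S where S: "C \<subseteq> S" "orthonormal_set M S"
    and max: "\<And>X. C \<subseteq> X \<Longrightarrow> orthonormal_set M X \<Longrightarrow> S \<subseteq> X \<Longrightarrow> X = S"
    by (auto simp: \<A>_def)
  have "AE x in M. f x = 0" if f: "f \<in> L2 M" and orth: "\<And>g. g \<in> S \<Longrightarrow> l2_inner M f g = 0" for f
  proof (rule ccontr)
    assume "\<not> (AE x in M. f x = 0)"
    then have pos: "0 < l2_inner M f f"
      using l2_inner_self_eq_0_iff[OF f] l2_inner_nonneg[of M f] by linarith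
    define h where "h x = 1 / sqrt (l2_inner M f f) * f x" for x
    have h: "h \<in> L2 M" unfolding h_def using f by blast
    have hh: "l2_inner M h h = 1"
      using pos by (simp add: h_def[abs_def] l2_inner_scale_left l2_inner_scale_right
          del: times_divide_eq_left) (simp add: real_div_sqrt field_simps)
    have hg: "l2_inner M h g = 0" if "g \<in> S" for g
      using orth[OF that] by (simp add: h_def[abs_def] l2_inner_scale_left del: times_divide_eq_left)
    then have gh: "l2_inner M g h = 0" if "g \<in> S" for g
      using that by (simp add: l2_inner_commute)
    have "h \<notin> S" using hg hh by fastforce
    then have "orthonormal_set M (insert h S)"
      using S(2) h hh hg gh by (auto simp: orthonormal_set_def)
    then have "insert h S = S" using S by (intro max) auto
    with \<open>h \<notin> S\<close> show False by blast
  qed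
  with S show ?thesis by (rule that)
qed

section \<open>Cholesky factorisation of positive semidefinite kernels\<close>

definition psd :: "(nat \<Rightarrow> nat \<Rightarrow> real) \<Rightarrow> bool" where
  "psd A \<longleftrightarrow> (\<forall>i j. A i j = A j i) \<and>
     (\<forall>S b. finite S \<longrightarrow> 0 \<le> (\<Sum>i\<in>S. \<Sum>j\<in>S. b i * b j * A i j))"

lemma psd_nonneg: "psd A \<Longrightarrow> finite S \<Longrightarrow> 0 \<le> (\<Sum>i\<in>S. \<Sum>j\<in>S. b i * b j * A i j)"
  unfolding psd_def by (elim conjE allE impE)

text \<open>Cauchy-Schwarz for the semi-inner product given by \<open>A\<close>, between the vector
  \<open>b\<close> on \<open>S\<close> and the unit vector at \<open>k\<close>. The first claim is
  the degenerate case: a vector of length zero is orthogonal to everything. In the second claim a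
  zero pivot turns the quotient into 0.\<close>

lemma psd_cauchy_schwarz:
  assumes A: "psd A" and S: "finite S"
  shows "A k k = 0 \<Longrightarrow> (\<Sum>i\<in>S. b i * A i k) = 0"
    and "(\<Sum>i\<in>S. b i * A i k)\<^sup>2 / A k k \<le> (\<Sum>i\<in>S. \<Sum>j\<in>S. b i * b j * A i j)"
proof -
  have sym: "A i j = A j i" for i j using A by (simp add: psd_def)
  \<comment> \<open>Extending \<open>b\<close> by zero to \<open>insert k S\<close> treats the cases
    of \<open>k\<close> inside and outside \<open>S\<close> alike.\<close>
  define c where "c i = (if i \<in> S then b i else 0)" for i
  define T where "T = insert k S"
  have T: "finite T" "k \<in> T" "S \<subseteq> T" using S by (auto simp: T_def)
  define l where "l = (\<Sum>i\<in>S. b i * A i k)"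
  define q where "q = (\<Sum>i\<in>S. \<Sum>j\<in>S. b i * b j * A i j)"
  have l: "(\<Sum>i\<in>T. c i * A i k) = l"
    unfolding l_def using T by (intro sum.mono_neutral_cong_right) (auto simp: c_def)
  have l': "(\<Sum>j\<in>T. c j * A k j) = l" using l by (simp add: sym[of k])
  have q: "(\<Sum>i\<in>T. \<Sum>j\<in>T. c i * c j * A i j) = q"
  proof -
    have "(\<Sum>j\<in>T. c i * c j * A i j) = (\<Sum>j\<in>S. c i * b j * A i j)" for i
      using T by (intro sum.mono_neutral_cong_right) (simp_all add: c_def)
    then show ?thesis
      unfolding q_def using T by (intro sum.mono_neutral_cong_right) (simp_all add: c_def)
  qed
  \<comment> \<open>The quadratic form evaluated at \<open>c\<close> plus \<open>t\<close> times the
    unit vector at \<open>k\<close>.\<close>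
  have main: "0 \<le> q + 2 * t * l + t\<^sup>2 * A k k" for t
  proof -
    define d where "d i = (if i = k then t else 0)" for i
    have d: "(\<Sum>i\<in>T. d i * g i) = t * g k" for g
      using T by (subst sum.remove[of _ k]) (simp_all add: d_def)
    have "0 \<le> (\<Sum>i\<in>T. \<Sum>j\<in>T. (c i + d i) * (c j + d j) * A i j)"
      by (rule psd_nonneg[OF A T(1)])
    also have "\<dots> = (\<Sum>i\<in>T. (\<Sum>j\<in>T. c i * c j * A i j) + c i * (\<Sum>j\<in>T. d j * A i j)
        + d i * ((\<Sum>j\<in>T. c j * A i j) + (\<Sum>j\<in>T. d j * A i j)))"
      by (simp add: distrib_left distrib_right sum.distrib sum_distrib_left mult.assoc add.assoc)
    also have "\<dots> = (\<Sum>i\<in>T. \<Sum>j\<in>T. c i * c j * A i j) + t * (\<Sum>i\<in>T. c i * A i k)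
        + t * ((\<Sum>j\<in>T. c j * A k j) + t * A k k)"
      unfolding sum.distrib d by (simp add: sum_distrib_left mult.left_commute)
    finally show ?thesis unfolding q l l' by (simp add: algebra_simps power2_eq_square)
  qed
  show z: "(\<Sum>i\<in>S. b i * A i k) = 0" if "A k k = 0"
  proof (rule ccontr)
    assume "(\<Sum>i\<in>S. b i * A i k) \<noteq> 0"
    then have "l \<noteq> 0" by (simp add: l_def)
    \<comment> \<open>With a zero diagonal entry the polynomial is affine in \<open>t\<close>, and
      this \<open>t\<close> gives it the value -1.\<close>
    then show False using main[of "- (q + 1) / (2 * l)"] that by (simp add: field_simps)
  qed
  have "l\<^sup>2 / A k k \<le> q"
  proof (cases "A k k = 0")
    case True
    then show ?thesis using main[of 0] by simp
  next
    case False
    \<comment> \<open>The minimiser of the quadratic polynomial in \<open>t\<close>.\<close>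
    have "0 \<le> q + 2 * (- l / A k k) * l + (- l / A k k)\<^sup>2 * A k k" by (rule main)
    also have "\<dots> = q - l\<^sup>2 / A k k" using False by (simp add: field_simps power2_eq_square)
    finally show ?thesis by simp
  qed
  then show "(\<Sum>i\<in>S. b i * A i k)\<^sup>2 / A k k \<le> (\<Sum>i\<in>S. \<Sum>j\<in>S. b i * b j * A i j)"
    by (simp add: l_def q_def)
qed

lemma psd_diagonal: "psd A \<Longrightarrow> 0 \<le> A k k"
  using psd_nonneg[of A "{k}" "\<lambda>_. 1"] by simp

text \<open>One elimination step with pivot \<open>A k k\<close>. The rank-one correction lowers the
  quadratic form by exactly the quotient that Cauchy-Schwarz bounds.\<close>

lemma psd_schur_complement:
  assumes A: "psd A"
  shows "psd (\<lambda>i j. A i j - A i k * A j k / A k k)"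
  unfolding psd_def
proof (intro conjI allI impI)
  have sym: "A i j = A j i" for i j using A by (simp add: psd_def)
  show "A i j - A i k * A j k / A k k = A j i - A j k * A i k / A k k" for i j
    by (simp add: sym[of i j] mult.commute)
  fix S :: "nat set" and b :: "nat \<Rightarrow> real" assume S: "finite S"
  have "(\<Sum>i\<in>S. \<Sum>j\<in>S. b i * b j * (A i j - A i k * A j k / A k k)) =
      (\<Sum>i\<in>S. \<Sum>j\<in>S. b i * b j * A i j) - (\<Sum>i\<in>S. \<Sum>j\<in>S. (b i * A i k) * (b j * A j k)) / A k k"
    by (simp add: algebra_simps sum_subtractf sum_divide_distrib)
  also have "\<dots> = (\<Sum>i\<in>S. \<Sum>j\<in>S. b i * b j * A i j) - (\<Sum>i\<in>S. b i * A i k)\<^sup>2 / A k k"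
    by (simp add: power2_eq_square sum_product)
  also have "\<dots> \<ge> 0" using psd_cauchy_schwarz(2)[OF A S] by simp
  finally show "0 \<le> (\<Sum>i\<in>S. \<Sum>j\<in>S. b i * b j * (A i j - A i k * A j k / A k k))" .
qed

text \<open>Symmetric Gaussian elimination. A vanishing pivot needs no special treatment: its column
  vanishes as well, and division by zero yields zero.\<close>
lemma psd_cholesky:
  assumes A: "psd A"
  shows "\<exists>L. \<forall>i j. (\<Sum>k\<le>min i j. L i k * L j k) = A i j"
proof -
  \<comment> \<open>\<open>R k\<close> is what remains of \<open>A\<close> after the pivots below
    \<open>k\<close> have been eliminated.\<close>
  define R where "R = rec_nat A (\<lambda>k B i j. B i j - B i k * B j k / B k k)"
  have R0: "R 0 = A" and RS: "R (Suc k) = (\<lambda>i j. R k i j - R k i k * R k j k / R k k k)" for k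
    by (simp_all add: R_def)
  have psd: "psd (R k)" for k
    by (induction k) (simp_all add: R0 RS A psd_schur_complement)
  have sym: "R k i j = R k j i" for k i j using psd[of k] by (simp add: psd_def)
  \<comment> \<open>Rows already eliminated stay zero. In row \<open>m\<close> a nonzero pivot
    cancels the entry, while a zero pivot forces the entry to be zero by the degenerate case of
    Cauchy-Schwarz.\<close>
  have zero: "R m i j = 0" if "i < m" for m i j
    using that
  proof (induction m arbitrary: i j)
    case (Suc m)
    show ?case
    proof (cases "i = m")
      case True
      have "R m j m = 0" if "R m m m = 0"
        using psd_cauchy_schwarz(1)[OF psd, of "{j}" m m "\<lambda>_. 1"] that by simp
      then show ?thesis using True by (auto simp: RS sym[of m m j])
    next
      case False
      then have "i < m" using Suc.prems by simp
      then show ?thesis using Suc.IH by (simp add: RS)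
    qed
  qed simp
  \<comment> \<open>The square root splits the rank-one term removed at step \<open>k\<close> evenly
    between its two factors, so the products \<open>L i k * L j k\<close> telescope.\<close>
  define L where "L i k = R k i k / sqrt (R k k k)" for i k
  have LL: "L i k * L j k = R k i j - R (Suc k) i j" for i j k
    using psd_diagonal[OF psd, of k k] by (simp add: L_def RS)
  show ?thesis
  proof (intro exI[of _ L] allI)
    fix i j
    have "R (Suc (min i j)) i j = 0"
      by (metis zero sym lessI min_def)
    then show "(\<Sum>k\<le>min i j. L i k * L j k) = A i j"
      using sum_telescope[of "\<lambda>k. R k i j"] by (simp add: LL R0)
  qed
qed

section \<open>Covers by small sets\<close>

text \<open>Repeated halving: a set of finite positive measure splits into two parts of positive
  measure, and one of them has at most half the measure.\<close>

lemma continuous_measure_small_subset: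
  assumes M: "continuous_measure M" and A: "A \<in> sets M" "0 < emeasure M A" and e: "0 < e"
  obtains B where "B \<in> sets M" "B \<subseteq> A" "0 < emeasure M B" "emeasure M B < \<infinity>" "measure M B < e"
proof -
  have split: "\<exists>C\<in>sets M. C \<subseteq> B \<and> 0 < emeasure M C \<and> emeasure M C < emeasure M B"
    if "B \<in> sets M" "0 < emeasure M B" for B
    using M that unfolding continuous_measure_def by blast
  \<comment> \<open>Finiteness comes from the strict inequality: anything of measure strictly below
    that of \<open>A\<close> has finite measure, even when \<open>A\<close> has not.\<close>
  obtain B0 where B0: "B0 \<in> sets M" "B0 \<subseteq> A" "0 < emeasure M B0" "emeasure M B0 < \<infinity>"
    using split[OF A] by (metis infinity_ennreal_def less_top order_less_le_trans top_greatest)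
  have "\<exists>B\<in>sets M. B \<subseteq> B0 \<and> 0 < emeasure M B \<and> measure M B \<le> measure M B0 / 2 ^ n" for n
  proof (induction n)
    case 0
    then show ?case using B0 by auto
  next
    case (Suc n)
    then obtain B where B: "B \<in> sets M" "B \<subseteq> B0" "0 < emeasure M B" "measure M B \<le> measure M B0 / 2 ^ n"
      by blast
    have Bf: "emeasure M B < \<infinity>"
      using emeasure_mono[OF B(2) B0(1)] B0(4) by (rule order_le_less_trans)
    obtain C where C: "C \<in> sets M" "C \<subseteq> B" "0 < emeasure M C" "emeasure M C < emeasure M B"
      using split[OF B(1,3)] by blast
    have Cf: "emeasure M C < \<infinity>" using C(4) Bf by (rule order_less_trans)
    have sum: "measure M (B - C) = measure M B - measure M C"
      using B C Bf Cf by (intro measure_Diff) auto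
    have "measure M C < measure M B"
      using C(4) Bf Cf by (simp add: measure_def enn2real_less_iff ennreal_enn2real_if)
    then have D: "0 < emeasure M (B - C)"
      using sum \<open>measure M C < measure M B\<close> by (intro zero_less_iff_neq_zero[THEN iffD2] notI) (simp add: measure_def)
    show ?case
    proof (cases "measure M C \<le> measure M B / 2")
      case True
      then show ?thesis using B C by (intro bexI[of _ C]) auto
    next
      case False
      then show ?thesis using sum D B C by (intro bexI[of _ "B - C"]) auto
    qed
  qed
  moreover obtain n where "measure M B0 / 2 ^ n < e"
  proof -
    have "(\<lambda>n. measure M B0 / 2 ^ n) \<longlonglongrightarrow> 0" by (rule LIMSEQ_divide_realpow_zero) simp
    then show ?thesis
      using e that by (metis (no_types, lifting) eventually_sequentially order_refl order_tendstoD(2))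
  qed
  ultimately obtain B where B: "B \<in> sets M" "B \<subseteq> B0" "0 < emeasure M B" "measure M B < e"
    by (meson order_le_less_trans)
  show ?thesis
  proof
    show "emeasure M B < \<infinity>"
      using emeasure_mono[OF B(2) B0(1)] B0(4) by (rule order_le_less_trans)
  qed (use B B0 in auto)
qed

lemma l2_inner_normalized_indicators:
  assumes A: "A \<in> sets M" "0 < emeasure M A" "emeasure M A < \<infinity>"
    and B: "B \<in> sets M" and AB: "A = B \<or> A \<inter> B = {}"
  shows "l2_inner M (\<lambda>x. 1 / sqrt (measure M A) * indicator A x) (\<lambda>x. 1 / sqrt (measure M B) * indicator B x)
    = (if A = B then 1 else 0)"
proof -
  have "0 < measure M A" using A by (simp add: measure_def enn2real_positive_iff)
  then have "1 / sqrt (measure M A) * (1 / sqrt (measure M B) * measure M (A \<inter> B)) = (if A = B then 1 else 0)"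
    using AB by auto
  then show ?thesis
    using A B by (simp only: l2_inner_scale_left l2_inner_scale_right l2_inner_indicator)
qed

text \<open>Turns a disjoint family of sets into an orthonormal set of the same cardinality, so that
  separability makes such families countable.\<close>

lemma orthonormal_disjoint_indicators:
  assumes "\<And>A. A \<in> \<F> \<Longrightarrow> A \<in> sets M \<and> 0 < emeasure M A \<and> emeasure M A < \<infinity>" "disjoint \<F>"
  shows "orthonormal_set M ((\<lambda>A x. 1 / sqrt (measure M A) * indicator A x) ` \<F>)"
    and "inj_on (\<lambda>A x. 1 / sqrt (measure M A) * indicator A x) \<F>"
proof -
  define h :: "'a set \<Rightarrow> 'a \<Rightarrow> real"
    where "h = (\<lambda>A x. 1 / sqrt (measure M A) * indicator A x)"
  have ip: "l2_inner M (h A) (h B) = (if A = B then 1 else 0)" if "A \<in> \<F>" "B \<in> \<F>" for A B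
    unfolding h_def using assms(1)[OF that(1)] assms(1)[OF that(2)] assms(2) that
    by (intro l2_inner_normalized_indicators) (auto simp: disjoint_def)
  have inj: "inj_on h \<F>"
    using ip by (metis (no_types, lifting) inj_onI zero_neq_one)
  have "h A \<in> L2 M" if "A \<in> \<F>" for A
    unfolding h_def using assms(1)[OF that] by (intro L2_scale L2_indicator) auto
  then have "orthonormal_set M (h ` \<F>)"
    using ip inj by (auto simp: orthonormal_set_def inj_on_eq_iff)
  then show "orthonormal_set M ((\<lambda>A x. 1 / sqrt (measure M A) * indicator A x) ` \<F>)"
    unfolding h_def .
  show "inj_on (\<lambda>A x. 1 / sqrt (measure M A) * indicator A x) \<F>"
    using inj unfolding h_def .
qed

text \<open>A maximal disjoint family of sets of positive measure at most \<open>e\<close> is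
  countable by separability. If its union missed a set of positive measure, a small subset of the
  missed part could be added to the family.\<close>

lemma continuous_measure_cover:
  assumes M: "continuous_measure M" and sep: "L2_separable M" and e: "0 < e"
  obtains Q :: "nat \<Rightarrow> 'a set" where "\<And>n. Q n \<in> sets M" "\<And>n. emeasure M (Q n) < \<infinity>"
    "\<And>n. measure M (Q n) \<le> e" "disjoint_family Q" "AE x in M. x \<in> (\<Union>n. Q n)"
proof -
  define P where "P A \<longleftrightarrow> A \<in> sets M \<and> 0 < emeasure M A \<and> emeasure M A < \<infinity> \<and> measure M A \<le> e" for A
  define \<A> where "\<A> = {\<F>. disjoint \<F> \<and> (\<forall>A\<in>\<F>. P A)}"
  have "\<exists>\<F>\<in>\<A>. \<forall>X\<in>\<A>. \<F> \<subseteq> X \<longrightarrow> X = \<F>"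
  proof (rule subset_Zorn_nonempty)
    show "\<A> \<noteq> {}" by (auto simp: \<A>_def intro: exI[of _ "{}"])
    fix \<C> assume ch: "subset.chain \<A> \<C>"
    have "A \<inter> B = {}" if AB: "A \<in> \<Union>\<C>" "B \<in> \<Union>\<C>" "A \<noteq> B" for A B
    proof -
      from AB obtain X Y where XY: "X \<in> \<C>" "A \<in> X" "Y \<in> \<C>" "B \<in> Y" by blast
      then have "X \<subseteq> Y \<or> Y \<subseteq> X" using ch by (auto simp: subset_chain_def)
      with XY obtain X where "X \<in> \<C>" "A \<in> X" "B \<in> X" by blast
      then show ?thesis using ch AB(3) by (auto simp: subset_chain_def \<A>_def disjoint_def)
    qed
    moreover have "P A" if "A \<in> \<Union>\<C>" for A
      using that ch by (auto simp: subset_chain_def \<A>_def)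
    ultimately show "\<Union>\<C> \<in> \<A>"
      by (simp add: \<A>_def disjoint_def)
  qed
  then obtain \<F> where "\<F> \<in> \<A>" and max': "\<And>X. X \<in> \<A> \<Longrightarrow> \<F> \<subseteq> X \<Longrightarrow> X = \<F>"
    by blast
  then have \<F>: "disjoint \<F>" "\<And>A. A \<in> \<F> \<Longrightarrow> P A" by (auto simp: \<A>_def)
  have max: "X = \<F>" if "disjoint X" "\<And>A. A \<in> X \<Longrightarrow> P A" "\<F> \<subseteq> X" for X
    using that by (intro max') (auto simp: \<A>_def)
  have "countable \<F>"
    using orthonormal_disjoint_indicators[of \<F> M] countable_orthonormal_set[OF sep] \<F>
    by (auto simp: P_def dest: countable_image_inj_on)
  \<comment> \<open>Indices that code no member get the empty set. This covers finite families and
    prevents repeated members, which would spoil disjointness.\<close>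
  define Q where "Q n = (if n \<in> to_nat_on \<F> ` \<F> then from_nat_into \<F> n else {})" for n
  have Q: "Q n \<in> \<F> \<or> Q n = {}" for n
    using from_nat_into_to_nat_on[OF \<open>countable \<F>\<close>] by (auto simp: Q_def)
  have un: "(\<Union>n. Q n) = \<Union>\<F>"
    using Q from_nat_into_to_nat_on[OF \<open>countable \<F>\<close>] by (auto simp: Q_def)
  have U: "\<Union>\<F> \<in> sets M" using \<open>countable \<F>\<close> \<F>(2) by (auto simp: P_def)
  have null: "emeasure M (space M - \<Union>\<F>) = 0"
  proof (rule ccontr)
    assume "emeasure M (space M - \<Union>\<F>) \<noteq> 0"
    then have pos: "0 < emeasure M (space M - \<Union>\<F>)" by (simp add: zero_less_iff_neq_zero)
    obtain B where B: "B \<in> sets M" "B \<subseteq> space M - \<Union>\<F>" "0 < emeasure M B" "emeasure M B < \<infinity>"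
        "measure M B < e"
      by (rule continuous_measure_small_subset[OF M sets.Diff[OF sets.top U] pos e])
    have "insert B \<F> = \<F>"
      using \<F> B by (intro max) (auto simp: disjoint_def P_def)
    then have "B \<subseteq> \<Union>\<F>" by blast
    then have "B = {}" using B(2) by blast
    then show False using B(3) by simp
  qed
  show ?thesis
  proof
    show "disjoint_family Q"
      unfolding disjoint_family_on_def
    proof (intro ballI impI)
      fix m n :: nat assume "m \<noteq> n"
      then show "Q m \<inter> Q n = {}"
        using \<F>(1) from_nat_into_to_nat_on[OF \<open>countable \<F>\<close>]
        by (auto simp: Q_def disjoint_def) (metis disjoint_iff)
    qed
    have "AE x in M. x \<notin> space M - \<Union>\<F>"
      by (rule AE_not_in) (use null U in auto)
    then show "AE x in M. x \<in> (\<Union>n. Q n)"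
      unfolding un using AE_space by eventually_elim auto
    fix n
    show "Q n \<in> sets M" "emeasure M (Q n) < \<infinity>" "measure M (Q n) \<le> e"
      using Q[of n] \<F>(2)[of "Q n"] e by (auto simp: P_def)
  qed
qed

section \<open>Nonnegative complete Bessel sequences\<close>

text \<open>Since the terms are nonnegative, one bound for all finite sums gives both summability
  and the Bessel bound; totality supplies a nonzero term, hence strict positivity.\<close>

lemma complete_besselI:
  assumes v: "\<And>n. v n \<in> L2 M" and B: "B > 0"
    and bound: "\<And>f S. f \<in> L2 M \<Longrightarrow> finite S \<Longrightarrow> (\<Sum>n\<in>S. (l2_inner M f (v n))\<^sup>2) \<le> B * l2_inner M f f"
    and total: "\<And>f. f \<in> L2 M \<Longrightarrow> (\<And>n. l2_inner M f (v n) = 0) \<Longrightarrow> AE x in M. f x = 0"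
  shows "complete_bessel M v"
  unfolding complete_bessel_def power2_abs
proof (intro conjI allI exI[of _ B] ballI impI)
  fix f assume f: "f \<in> L2 M" and nz: "\<not> (AE x in M. f x = 0)"
  show summ: "summable (\<lambda>n. (l2_inner M f (v n))\<^sup>2)"
    by (rule summableI_nonneg_bounded[where x = "B * l2_inner M f f"]) (auto intro: bound f)
  show "(\<Sum>n. (l2_inner M f (v n))\<^sup>2) \<le> B * l2_inner M f f"
    by (rule suminf_le_const[OF summ]) (auto intro: bound f)
  obtain n where "l2_inner M f (v n) \<noteq> 0" using total[OF f] nz by blast
  then show "0 < (\<Sum>n. (l2_inner M f (v n))\<^sup>2)"
    by (intro suminf_pos2[OF summ, of n]) auto
qed (use v B in auto)

text \<open>Cauchy-Schwarz on each \<open>Q n\<close> costs a factor at most \<open>e\<close> and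
  leaves the squared norm of \<open>f\<close> restricted to \<open>Q n\<close>. These restrictions
  have disjoint supports, so their squared norms add up to at most that of \<open>f\<close>.\<close>

lemma bessel_disjoint_indicators:
  assumes Q: "\<And>n. Q n \<in> sets M" "\<And>n. emeasure M (Q n) < \<infinity>" "\<And>n. measure M (Q n) \<le> e"
    and disj: "disjoint_family Q" and f: "f \<in> L2 M" and S: "finite S"
  shows "(\<Sum>n\<in>S. (l2_inner M f (indicator (Q n)))\<^sup>2) \<le> e * l2_inner M f f"
proof -
  define g where "g n x = indicator (Q n) x * f x" for n x
  have fm: "f \<in> borel_measurable M" using f by (rule L2_measurable)
  have g: "g n \<in> L2 M" for n
    by (rule L2_dominated[OF f]) (use Q(1) fm in \<open>auto simp: g_def[abs_def] indicator_def\<close>)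
  have "(l2_inner M f (indicator (Q n)))\<^sup>2 \<le> e * l2_inner M (g n) (g n)" for n
  proof -
    have "l2_inner M f (indicator (Q n)) = l2_inner M (g n) (indicator (Q n))"
      unfolding l2_inner_def g_def by (intro Bochner_Integration.integral_cong) (auto simp: indicator_def)
    also have "\<dots>\<^sup>2 \<le> l2_inner M (g n) (g n) * l2_inner M (indicator (Q n)) (indicator (Q n))"
      using Q by (intro l2_cauchy_schwarz g L2_indicator)
    also have "\<dots> \<le> l2_inner M (g n) (g n) * e"
      using Q by (intro mult_left_mono) (auto simp: l2_inner_indicator l2_inner_nonneg)
    finally show ?thesis by (simp add: mult.commute)
  qed
  then have "(\<Sum>n\<in>S. (l2_inner M f (indicator (Q n)))\<^sup>2) \<le> e * (\<Sum>n\<in>S. l2_inner M (g n) (g n))"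
    by (simp add: sum_distrib_left sum_mono)
  moreover have "(\<Sum>n\<in>S. l2_inner M (g n) (g n)) \<le> l2_inner M f f"
  proof -
    have "(\<Sum>n\<in>S. l2_inner M (g n) (g n)) = (\<integral>x. (\<Sum>n\<in>S. g n x * g n x) \<partial>M)"
      by (simp add: l2_inner_def L2_mult_integrable[OF g g])
    also have "\<dots> \<le> l2_inner M f f"
      unfolding l2_inner_def
    proof (rule integral_mono)
      fix x
      have "(\<Sum>n\<in>S. g n x * g n x) = (\<Sum>n\<in>S. indicator (Q n) x) * (f x * f x)"
        unfolding sum_distrib_right by (intro sum.cong) (auto simp: g_def indicator_def)
      also have "(\<Sum>n\<in>S. indicator (Q n) x) = (indicator (\<Union>n\<in>S. Q n) x :: real)"
        using S disj by (intro indicator_UN_disjoint[symmetric]) (auto simp: disjoint_family_on_def)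
      also have "indicator (\<Union>n\<in>S. Q n) x * (f x * f x) \<le> f x * f x"
        by (auto simp: indicator_def)
      finally show "(\<Sum>n\<in>S. g n x * g n x) \<le> f x * f x" .
    qed (intro Bochner_Integration.integrable_sum L2_mult_integrable f g)+
    finally show ?thesis .
  qed
  moreover have "0 \<le> e" using Q(3) measure_nonneg by (rule order_trans[rotated])
  ultimately show ?thesis by (meson mult_left_mono order_trans)
qed

lemma conditions_123_exists:
  assumes M: "continuous_measure M" and sep: "L2_separable M"
  obtains v where "conditions_123 M v"
proof -
  obtain D :: "nat \<Rightarrow> 'a \<Rightarrow> real" where D: "\<And>n. D n \<in> L2 M"
    and dense: "\<And>f e. f \<in> L2 M \<Longrightarrow> e > 0 \<Longrightarrow> \<exists>n. l2_inner M (\<lambda>x. f x - D n x) (\<lambda>x. f x - D n x) < e"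
    using sep unfolding L2_separable_def by blast
  have "\<exists>Q :: nat \<Rightarrow> 'a set. (\<forall>n. Q n \<in> sets M) \<and> (\<forall>n. emeasure M (Q n) < \<infinity>) \<and>
      (\<forall>n. measure M (Q n) \<le> 1 / 2 ^ k) \<and> disjoint_family Q \<and> (AE x in M. x \<in> (\<Union>n. Q n))" for k :: nat
    by (rule continuous_measure_cover[OF M sep, of "1 / 2 ^ k"]) (simp, blast)
  then obtain Q :: "nat \<Rightarrow> nat \<Rightarrow> 'a set" where Q: "\<And>k n. Q k n \<in> sets M"
      "\<And>k n. emeasure M (Q k n) < \<infinity>" "\<And>k n. measure M (Q k n) \<le> 1 / 2 ^ k"
    and disj: "\<And>k. disjoint_family (Q k)" and cover: "\<And>k. AE x in M. x \<in> (\<Union>n. Q k n)"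
    by metis
  \<comment> \<open>The factor makes both \<open>c k\<close> at most 1 and \<open>c k\<close> times
    the squared norm of \<open>D k\<close> at most \<open>1 / 2 ^ k\<close>. The summand 1 keeps the
    denominator positive when \<open>D k\<close> vanishes.\<close>
  define c where "c k = 1 / (2 ^ k * (1 + l2_inner M (D k) (D k)))" for k
  have c_pos: "0 < c k" for k
    using l2_inner_nonneg[of M "D k"] by (simp add: c_def add_pos_nonneg)
  have c_bound: "(c k)\<^sup>2 * l2_inner M (D k) (D k) \<le> 1 / 2 ^ k" for k
  proof -
    define d where "d = l2_inner M (D k) (D k)"
    have d: "0 \<le> d" by (simp add: d_def l2_inner_nonneg)
    have "c k * d \<le> 1 / 2 ^ k"
    proof -
      have "c k * d = 1 / 2 ^ k * (d / (1 + d))" by (simp add: c_def d_def)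
      also have "\<dots> \<le> 1 / 2 ^ k * 1" using d by (intro mult_left_mono) auto
      finally show ?thesis by simp
    qed
    moreover have "c k \<le> 1"
    proof -
      have "1 * 1 \<le> 2 ^ k * (1 + d)" using d by (intro mult_mono) auto
      then show ?thesis using d by (simp add: c_def flip: d_def)
    qed
    ultimately have "c k * (c k * d) \<le> 1 * (1 / 2 ^ k)"
      using c_pos[of k] d by (intro mult_mono) auto
    then show ?thesis by (simp add: d_def power2_eq_square mult.assoc)
  qed
  \<comment> \<open>Splitting \<open>D k\<close> into positive and negative parts keeps every
    function nonnegative, and orthogonality to both parts still gives orthogonality to
    \<open>D k\<close>.\<close>
  define p where "p k x = max 0 (D k x)" for k x
  define q where "q k x = max 0 (- D k x)" for k x
  have p: "p k \<in> L2 M" and q: "q k \<in> L2 M" for k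
    using L2_measurable[OF D[of k]]
    by (auto intro!: L2_dominated[OF D[of k]] simp: p_def[abs_def] q_def[abs_def])
  have small: "(l2_inner M f (\<lambda>x. c k * h x))\<^sup>2 \<le> 1 / 2 ^ k * l2_inner M f f"
    if f: "f \<in> L2 M" and h: "h \<in> L2 M" and le: "\<And>x. \<bar>h x\<bar> \<le> \<bar>D k x\<bar>" for f h k
  proof -
    have "l2_inner M h h \<le> l2_inner M (D k) (D k)"
      unfolding l2_inner_def using le
      by (intro integral_mono L2_mult_integrable h D) (simp add: abs_le_square_iff flip: power2_eq_square)
    have "(l2_inner M f (\<lambda>x. c k * h x))\<^sup>2 = (c k)\<^sup>2 * (l2_inner M f h)\<^sup>2"
      by (simp add: l2_inner_scale_right power_mult_distrib)
    also have "\<dots> \<le> (c k)\<^sup>2 * (l2_inner M f f * l2_inner M (D k) (D k))"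
      using l2_cauchy_schwarz[OF f h] \<open>l2_inner M h h \<le> _\<close>
      by (intro mult_left_mono) (auto intro: order_trans mult_left_mono l2_inner_nonneg)
    also have "\<dots> = (c k)\<^sup>2 * l2_inner M (D k) (D k) * l2_inner M f f" by simp
    also have "\<dots> \<le> 1 / 2 ^ k * l2_inner M f f"
      by (intro mult_right_mono c_bound l2_inner_nonneg)
    finally show ?thesis .
  qed
  \<comment> \<open>Stage \<open>k\<close> consists of the two scaled parts of \<open>D k\<close>,
    followed by the indicators of the \<open>k\<close>-th cover.\<close>
  define w where "w k j = (case j of 0 \<Rightarrow> \<lambda>x. c k * p k x | Suc 0 \<Rightarrow> \<lambda>x. c k * q k x
      | Suc (Suc i) \<Rightarrow> indicator (Q k i))" for k and j :: nat
  have w_simps: "w k 0 = (\<lambda>x. c k * p k x)" "w k (Suc 0) = (\<lambda>x. c k * q k x)"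
    "w k (Suc (Suc i)) = indicator (Q k i)" for k i
    by (simp_all add: w_def)
  have w_cases: "P (w k j)" if "P (w k 0)" "P (w k (Suc 0))" "\<And>i. P (w k (Suc (Suc i)))" for P k j
    using that by (metis not0_implies_Suc)
  have w: "w k j \<in> L2 M" for k j
    by (rule w_cases) (use p q Q in \<open>auto simp: w_simps intro: L2_indicator\<close>)
  have w_nonneg: "0 \<le> w k j x" for k j x
    by (rule w_cases[of "\<lambda>u. 0 \<le> u x"]) (use c_pos[of k] in \<open>auto simp: w_simps p_def q_def\<close>)
  \<comment> \<open>The two parts of \<open>D k\<close> and the whole cover contribute at most
    \<open>1 / 2 ^ k\<close> times the squared norm of \<open>f\<close> each, whence the 3.\<close>
  have stage: "(\<Sum>j<Suc (Suc N). (l2_inner M f (w k j))\<^sup>2) \<le> 3 * l2_inner M f f * (1 / 2) ^ k"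
    if f: "f \<in> L2 M" for f k N
  proof -
    have "(\<Sum>j<Suc (Suc N). (l2_inner M f (w k j))\<^sup>2) = (l2_inner M f (w k 0))\<^sup>2
        + ((l2_inner M f (w k (Suc 0)))\<^sup>2 + (\<Sum>j<N. (l2_inner M f (w k (Suc (Suc j))))\<^sup>2))"
      by (simp only: sum.lessThan_Suc_shift)
    also have "\<dots> \<le> 1 / 2 ^ k * l2_inner M f f + (1 / 2 ^ k * l2_inner M f f + 1 / 2 ^ k * l2_inner M f f)"
      unfolding w_simps
      by (intro add_mono small bessel_disjoint_indicators f p q Q disj) (auto simp: p_def q_def)
    finally show ?thesis by (simp add: power_one_over)
  qed
  define v where "v n = w (fst (prod_decode n)) (snd (prod_decode n))" for n
  have v_encode: "v (prod_encode (k, j)) = w k j" for k j by (simp add: v_def)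
  \<comment> \<open>A finite set of codes is enlarged to a rectangle of index pairs. The constant is
    3 from each stage times the bound 2 for the geometric sum.\<close>
  have bound: "(\<Sum>n\<in>S. (l2_inner M f (v n))\<^sup>2) \<le> 6 * l2_inner M f f"
    if f: "f \<in> L2 M" and S: "finite S" for f S
  proof -
    define T where "T = prod_decode ` S"
    obtain K where K: "fst ` T \<subseteq> {..<K}"
      using S finite_nat_bounded[of "fst ` T"] by (auto simp: T_def)
    obtain N where N: "snd ` T \<subseteq> {..<N}"
      using S finite_nat_bounded[of "snd ` T"] by (auto simp: T_def)
    have sub: "T \<subseteq> {..<K} \<times> {..<Suc (Suc N)}" using K N by force
    have "(\<Sum>n\<in>S. (l2_inner M f (v n))\<^sup>2) = (\<Sum>(k, j)\<in>T. (l2_inner M f (w k j))\<^sup>2)"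
      unfolding T_def by (subst sum.reindex) (auto simp: v_def inj_prod_decode case_prod_unfold)
    also have "\<dots> \<le> (\<Sum>(k, j)\<in>{..<K} \<times> {..<Suc (Suc N)}. (l2_inner M f (w k j))\<^sup>2)"
      by (rule sum_mono2[OF _ sub]) auto
    also have "\<dots> = (\<Sum>k<K. \<Sum>j<Suc (Suc N). (l2_inner M f (w k j))\<^sup>2)"
      by (rule sum.cartesian_product[symmetric])
    also have "\<dots> \<le> (\<Sum>k<K. 3 * l2_inner M f f * (1 / 2) ^ k)"
      by (intro sum_mono stage f)
    also have "\<dots> = 3 * l2_inner M f f * (\<Sum>k<K. (1 / 2) ^ k)"
      by (simp add: sum_distrib_left)
    also have "\<dots> \<le> 3 * l2_inner M f f * 2"
    proof (intro mult_left_mono)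
      show "(\<Sum>k<K. (1 / 2) ^ k) \<le> (2 :: real)"
        by (simp add: sum_gp_strict)
    qed (simp add: l2_inner_nonneg)
    finally show ?thesis by simp
  qed
  have total: "AE x in M. f x = 0" if f: "f \<in> L2 M" and z: "\<And>n. l2_inner M f (v n) = 0" for f
  proof -
    have "l2_inner M f (p k) = 0" "l2_inner M f (q k) = 0" for k
      using z[of "prod_encode (k, 0)"] z[of "prod_encode (k, Suc 0)"] c_pos[of k]
      by (auto simp: v_encode w_simps l2_inner_scale_right)
    moreover have "D k = (\<lambda>x. p k x - q k x)" for k by (auto simp: p_def q_def)
    ultimately have fD: "l2_inner M f (D k) = 0" for k
      by (simp add: l2_inner_diff_right f p q)
    have "l2_inner M f f < e" if e: "e > 0" for e
    proof -
      obtain n where n: "l2_inner M (\<lambda>x. f x - D n x) (\<lambda>x. f x - D n x) < e"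
        using dense[OF f e] by blast
      \<comment> \<open>Pythagoras: \<open>f\<close> is orthogonal to \<open>D n\<close>, so no
        \<open>D n\<close> approximates \<open>f\<close> better than 0 does, and density forces the
        norm of \<open>f\<close> to vanish.\<close>
      have "l2_inner M (\<lambda>x. f x - D n x) (\<lambda>x. f x - D n x) = l2_inner M f f + l2_inner M (D n) (D n)"
        using f D[of n] fD by (simp add: l2_inner_diff_left l2_inner_diff_right L2_diff
            l2_inner_commute[of M "D n" f])
      then show ?thesis using n l2_inner_nonneg[of M "D n"] by linarith
    qed
    then have "l2_inner M f f = 0" using l2_inner_nonneg[of M f] by (metis less_irrefl order_le_less)
    then show ?thesis using l2_inner_self_eq_0_iff[OF f] by blast
  qed
  have "complete_bessel M v"
    by (rule complete_besselI[where B = 6]) (use w bound total in \<open>auto simp: v_def\<close>)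
  moreover have "AE x in M. (\<Sum>n. ennreal ((v n x)\<^sup>2)) = \<infinity>"
  proof -
    have "AE x in M. \<forall>k. x \<in> (\<Union>n. Q k n)" unfolding AE_all_countable by (intro allI cover)
    then show ?thesis
    proof eventually_elim
      case (elim x)
      then have "\<forall>k. \<exists>n. x \<in> Q k n" by auto
      \<comment> \<open>Choosing the cell that contains \<open>x\<close> in each cover gives
        infinitely many distinct indices at which \<open>v\<close> takes the value 1 at
        \<open>x\<close>.\<close>
      from choice[OF this] obtain j where j: "\<And>k. x \<in> Q k (j k)" by blast
      define i where "i k = prod_encode (k, Suc (Suc (j k)))" for k
      have inj: "inj i" by (auto simp: inj_def i_def)
      have "of_nat K \<le> (\<Sum>n. ennreal ((v n x)\<^sup>2))" for K
      proof -
        have "of_nat K = (\<Sum>k<K. ennreal ((v (i k) x)\<^sup>2))"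
          using j by (simp add: i_def v_encode w_simps)
        also have "\<dots> = (\<Sum>n\<in>i ` {..<K}. ennreal ((v n x)\<^sup>2))"
          by (subst sum.reindex) (auto intro: inj_on_subset[OF inj])
        also have "\<dots> \<le> (\<Sum>n. ennreal ((v n x)\<^sup>2))"
          by (rule sum_le_suminf) auto
        finally show ?thesis .
      qed
      then show ?case
        by (metis ennreal_Ex_less_of_nat infinity_ennreal_def less_top leD)
    qed
  qed
  ultimately have "conditions_123 M v"
    unfolding conditions_123_def using w w_nonneg by (auto simp: v_def)
  then show ?thesis by (rule that)
qed

section \<open>Restriction to a subset\<close>

lemma l2_inner_restrict_space:
  assumes "E \<in> sets M"
  shows "l2_inner (restrict_space M E) f g = l2_inner M (\<lambda>x. indicator E x * f x) (\<lambda>x. indicator E x * g x)"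
proof -
  have "l2_inner (restrict_space M E) f g = (\<integral>x. indicator E x *\<^sub>R (f x * g x) \<partial>M)"
    using assms by (simp add: l2_inner_def integral_restrict_space)
  also have "\<dots> = l2_inner M (\<lambda>x. indicator E x * f x) (\<lambda>x. indicator E x * g x)"
    unfolding l2_inner_def by (intro Bochner_Integration.integral_cong) (auto simp: indicator_def)
  finally show ?thesis .
qed

lemma L2_restrict_space_iff:
  assumes "E \<in> sets M"
  shows "f \<in> L2 (restrict_space M E) \<longleftrightarrow> (\<lambda>x. indicator E x * f x) \<in> L2 M"
proof -
  have "indicator E x *\<^sub>R (f x)\<^sup>2 = (indicator E x * f x)\<^sup>2" for x
    by (simp add: indicator_def)
  then show ?thesis
    using assms by (simp add: L2_def integrable_restrict_space borel_measurable_restrict_space_iff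
        mult.commute)
qed

lemma L2_restrict_space:
  assumes "E \<in> sets M" "f \<in> L2 M"
  shows "f \<in> L2 (restrict_space M E)"
  unfolding L2_restrict_space_iff[OF assms(1)]
  using assms(1) L2_measurable[OF assms(2)]
  by (intro L2_dominated[OF assms(2)]) (auto simp: indicator_def)

lemma continuous_measure_restrict_space:
  assumes M: "continuous_measure M" and E: "E \<in> sets M"
  shows "continuous_measure (restrict_space M E)"
  unfolding continuous_measure_def
proof (intro ballI impI)
  fix A assume A: "A \<in> sets (restrict_space M E)" "0 < emeasure (restrict_space M E) A"
  have E': "E \<inter> space M \<in> sets M" using E by simp
  have sub: "A \<in> sets M" "A \<subseteq> E"
    using A(1) E by (auto simp: sets_restrict_space_iff[OF E'])
  have eq: "emeasure (restrict_space M E) B = emeasure M B" if "B \<subseteq> E" for B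
    using that by (intro emeasure_restrict_space E') auto
  obtain B where "B \<in> sets M" "B \<subseteq> A" "0 < emeasure M B" "emeasure M B < emeasure M A"
    using M A(2) sub unfolding continuous_measure_def eq[OF sub(2)] by blast
  then show "\<exists>B\<in>sets (restrict_space M E). B \<subseteq> A \<and> 0 < emeasure (restrict_space M E) B
      \<and> emeasure (restrict_space M E) B < emeasure (restrict_space M E) A"
    using sub eq by (intro bexI[of _ B]) (auto simp: sets_restrict_space_iff[OF E'])
qed

text \<open>The same dense sequence serves: extend \<open>f\<close> by zero, approximate it on the
  whole space, and note that the error over \<open>E\<close> alone is no larger.\<close>

lemma L2_separable_restrict_space:
  assumes sep: "L2_separable M" and E: "E \<in> sets M"
  shows "L2_separable (restrict_space M E)"
proof -
  obtain D :: "nat \<Rightarrow> 'a \<Rightarrow> real" where D: "\<And>n. D n \<in> L2 M"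
    and dense: "\<And>f e. f \<in> L2 M \<Longrightarrow> e > 0 \<Longrightarrow> \<exists>n. l2_inner M (\<lambda>x. f x - D n x) (\<lambda>x. f x - D n x) < e"
    using sep unfolding L2_separable_def by blast
  show ?thesis
    unfolding L2_separable_def
  proof (intro exI[of _ D] conjI allI ballI impI)
    show "D n \<in> L2 (restrict_space M E)" for n using L2_restrict_space[OF E D] .
    fix f and e :: real assume f: "f \<in> L2 (restrict_space M E)" and e: "e > 0"
    let ?f = "\<lambda>x. indicator E x * f x"
    have f': "?f \<in> L2 M" using f by (simp add: L2_restrict_space_iff[OF E])
    obtain n where n: "l2_inner M (\<lambda>x. ?f x - D n x) (\<lambda>x. ?f x - D n x) < e"
      using dense[OF f' e] by blast
    have g: "(\<lambda>x. ?f x - D n x) \<in> L2 M" using f' D by (rule L2_diff)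
    have h: "(\<lambda>x. indicator E x * (f x - D n x)) \<in> L2 M"
    proof -
      have "(\<lambda>x. f x - D n x) \<in> L2 (restrict_space M E)"
        using f L2_restrict_space[OF E D] by (rule L2_diff)
      then show ?thesis by (simp add: L2_restrict_space_iff[OF E])
    qed
    have "l2_inner (restrict_space M E) (\<lambda>x. f x - D n x) (\<lambda>x. f x - D n x)
        = l2_inner M (\<lambda>x. indicator E x * (f x - D n x)) (\<lambda>x. indicator E x * (f x - D n x))"
      by (rule l2_inner_restrict_space[OF E])
    also have "\<dots> \<le> l2_inner M (\<lambda>x. ?f x - D n x) (\<lambda>x. ?f x - D n x)"
      unfolding l2_inner_def
      by (intro integral_mono L2_mult_integrable g h) (auto simp: indicator_def)
    finally show "\<exists>n. l2_inner (restrict_space M E) (\<lambda>x. f x - D n x) (\<lambda>x. f x - D n x) < e"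
      using n by (intro exI[of _ n]) linarith
  qed
qed

section \<open>Normalised Bessel sequences and their Gram matrices\<close>

lemma conditions_123_cong:
  assumes eq: "\<And>n x. x \<in> space M \<Longrightarrow> v n x = w n x"
  shows "conditions_123 M v \<longleftrightarrow> conditions_123 M w"
proof -
  have "v n \<in> L2 M \<longleftrightarrow> w n \<in> L2 M" for n using eq by (rule L2_cong)
  moreover have "l2_inner M f (v n) = l2_inner M f (w n)" for f n
    using eq by (intro l2_inner_cong) auto
  moreover have "(AE x in M. \<forall>n. 0 \<le> v n x) \<longleftrightarrow> (AE x in M. \<forall>n. 0 \<le> w n x)"
    by (intro AE_cong) (simp add: eq)
  moreover have "(AE x in M. (\<Sum>n. ennreal ((v n x)\<^sup>2)) = \<infinity>) \<longleftrightarrow> (AE x in M. (\<Sum>n. ennreal ((w n x)\<^sup>2)) = \<infinity>)"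
    by (intro AE_cong) (simp add: eq)
  ultimately show ?thesis unfolding conditions_123_def complete_bessel_def by simp
qed

lemma conditions_123_scale:
  assumes v: "conditions_123 M v" and c: "0 < c"
  shows "conditions_123 M (\<lambda>n x. c * v n x)"
proof -
  have vL: "v n \<in> L2 M" for n using v by (simp add: conditions_123_def)
  obtain B where B: "B > 0" and bessel: "\<And>f. f \<in> L2 M \<Longrightarrow> \<not> (AE x in M. f x = 0) \<Longrightarrow>
        summable (\<lambda>n. \<bar>l2_inner M f (v n)\<bar>\<^sup>2) \<and>
        0 < (\<Sum>n. \<bar>l2_inner M f (v n)\<bar>\<^sup>2) \<and>
        (\<Sum>n. \<bar>l2_inner M f (v n)\<bar>\<^sup>2) \<le> B * l2_inner M f f"
    using v unfolding conditions_123_def complete_bessel_def by metis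
  have eq: "\<bar>l2_inner M f (\<lambda>x. c * v n x)\<bar>\<^sup>2 = c\<^sup>2 * \<bar>l2_inner M f (v n)\<bar>\<^sup>2" for f n
    using c by (simp add: l2_inner_scale_right power_mult_distrib)
  have "complete_bessel M (\<lambda>n x. c * v n x)"
    unfolding complete_bessel_def eq
  proof (intro conjI allI exI[of _ "c\<^sup>2 * B"] ballI impI)
    fix f assume "f \<in> L2 M" "\<not> (AE x in M. f x = 0)"
    note b = bessel[OF this]
    show "summable (\<lambda>n. c\<^sup>2 * \<bar>l2_inner M f (v n)\<bar>\<^sup>2)" using b by (intro summable_mult) blast
    have s: "(\<Sum>n. c\<^sup>2 * \<bar>l2_inner M f (v n)\<bar>\<^sup>2) = c\<^sup>2 * (\<Sum>n. \<bar>l2_inner M f (v n)\<bar>\<^sup>2)"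
      using b by (intro suminf_mult) blast
    show "0 < (\<Sum>n. c\<^sup>2 * \<bar>l2_inner M f (v n)\<bar>\<^sup>2)" unfolding s using b c by simp
    show "(\<Sum>n. c\<^sup>2 * \<bar>l2_inner M f (v n)\<bar>\<^sup>2) \<le> c\<^sup>2 * B * l2_inner M f f"
      unfolding s using b c by (simp add: mult.assoc)
  qed (use c B vL in auto)
  moreover have "AE x in M. (\<Sum>n. ennreal ((c * v n x)\<^sup>2)) = \<infinity>"
  proof -
    have "AE x in M. (\<Sum>n. ennreal ((v n x)\<^sup>2)) = \<infinity>" using v by (simp add: conditions_123_def)
    then show ?thesis
    proof eventually_elim
      case (elim x)
      have "(\<Sum>n. ennreal ((c * v n x)\<^sup>2)) = (\<Sum>n. ennreal (c\<^sup>2) * ennreal ((v n x)\<^sup>2))"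
        by (simp add: power_mult_distrib ennreal_mult)
      then show ?case using elim c by (simp add: ennreal_mult_eq_top_iff)
    qed
  qed
  moreover have "AE x in M. \<forall>n. 0 \<le> c * v n x"
  proof -
    have "AE x in M. \<forall>n. 0 \<le> v n x" using v by (simp add: conditions_123_def)
    then show ?thesis by eventually_elim (use c in auto)
  qed
  ultimately show ?thesis using vL by (auto simp: conditions_123_def)
qed

text \<open>Dividing by \<open>sqrt B\<close> brings the Bessel bound to 1. It is stated for finite
  sums, the form in which the Gram matrix argument uses it.\<close>

lemma conditions_123_unit_bound:
  assumes v: "conditions_123 M v"
  obtains w where "conditions_123 M w"
    "\<And>f S. f \<in> L2 M \<Longrightarrow> finite S \<Longrightarrow> (\<Sum>n\<in>S. (l2_inner M f (w n))\<^sup>2) \<le> l2_inner M f f"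
proof -
  obtain B where B: "B > 0" and bessel: "\<And>f. f \<in> L2 M \<Longrightarrow> \<not> (AE x in M. f x = 0) \<Longrightarrow>
        summable (\<lambda>n. \<bar>l2_inner M f (v n)\<bar>\<^sup>2) \<and>
        (\<Sum>n. \<bar>l2_inner M f (v n)\<bar>\<^sup>2) \<le> B * l2_inner M f f"
    using v unfolding conditions_123_def complete_bessel_def by metis
  define c where "c = 1 / sqrt B"
  have c: "0 < c" "c\<^sup>2 * B = 1" using B by (simp_all add: c_def power_divide)
  show ?thesis
  proof
    show "conditions_123 M (\<lambda>n x. c * v n x)" using v c(1) by (rule conditions_123_scale)
    fix f and S :: "nat set" assume f: "f \<in> L2 M" and S: "finite S"
    show "(\<Sum>n\<in>S. (l2_inner M f (\<lambda>x. c * v n x))\<^sup>2) \<le> l2_inner M f f"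
    proof (cases "AE x in M. f x = 0")
      \<comment> \<open>\<open>complete_bessel\<close> says nothing about null functions, so they
        are treated apart.\<close>
      case True
      then show ?thesis by (simp add: l2_inner_AE_zero)
    next
      case False
      have "(\<Sum>n\<in>S. (l2_inner M f (v n))\<^sup>2) \<le> (\<Sum>n. \<bar>l2_inner M f (v n)\<bar>\<^sup>2)"
        using bessel[OF f False] S by (simp add: sum_le_suminf)
      also have "\<dots> \<le> B * l2_inner M f f" using bessel[OF f False] by blast
      finally have "c\<^sup>2 * (\<Sum>n\<in>S. (l2_inner M f (v n))\<^sup>2) \<le> c\<^sup>2 * (B * l2_inner M f f)"
        by (intro mult_left_mono) auto
      also have "\<dots> = l2_inner M f f" using c(2) by (simp flip: mult.assoc)
      finally show ?thesis
        by (simp add: l2_inner_scale_right power_mult_distrib sum_distrib_left)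
    qed
  qed
qed

text \<open>Duality: sending \<open>f\<close> to its coefficients against \<open>v\<close> is a
  contraction, hence so is its adjoint, which sends \<open>b\<close> to the combination
  \<open>g\<close>. That the squared norm of \<open>g\<close> is at most the sum of the squares of
  \<open>b\<close> is the claim.\<close>

lemma psd_one_minus_gram:
  assumes v: "\<And>n. v n \<in> L2 M"
    and bessel: "\<And>f S. f \<in> L2 M \<Longrightarrow> finite S \<Longrightarrow> (\<Sum>n\<in>S. (l2_inner M f (v n))\<^sup>2) \<le> l2_inner M f f"
  shows "psd (\<lambda>i j. of_bool (i = j) - l2_inner M (v i) (v j))"
  unfolding psd_def
proof (intro conjI allI impI)
  show "of_bool (i = j) - l2_inner M (v i) (v j) = of_bool (j = i) - l2_inner M (v j) (v i)" for i j
    by (auto simp: l2_inner_commute)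
  fix S :: "nat set" and b :: "nat \<Rightarrow> real" assume S: "finite S"
  define g where "g x = (\<Sum>i\<in>S. b i * v i x)" for x
  define s where "s = (\<Sum>i\<in>S. (b i)\<^sup>2)"
  define G where "G = l2_inner M g g"
  have g: "g \<in> L2 M" unfolding g_def by (intro L2_sum L2_scale v)
  have gh: "l2_inner M h g = (\<Sum>i\<in>S. b i * l2_inner M h (v i))" if "h \<in> L2 M" for h
    unfolding g_def using v that by (subst l2_inner_sum_right) (auto simp: l2_inner_scale_right)
  \<comment> \<open>Cauchy-Schwarz in the coefficients and the Bessel bound applied to
    \<open>g\<close> itself give \<open>G * G\<close> at most \<open>s * G\<close>; one factor
    \<open>G\<close> then cancels.\<close>
  have "G\<^sup>2 = (\<Sum>i\<in>S. b i * l2_inner M g (v i))\<^sup>2" by (simp add: G_def gh[OF g])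
  also have "\<dots> \<le> s * (\<Sum>i\<in>S. (l2_inner M g (v i))\<^sup>2)"
    unfolding s_def by (rule Cauchy_Schwarz_ineq_sum)
  also have "\<dots> \<le> s * G"
    unfolding G_def by (intro mult_left_mono bessel g S) (simp add: s_def sum_nonneg)
  finally have "G * G \<le> s * G" by (simp add: power2_eq_square)
  moreover have "0 \<le> G" "0 \<le> s" by (simp_all add: G_def l2_inner_nonneg s_def sum_nonneg)
  ultimately have "G \<le> s" by (cases "G = 0") auto
  also have "G = (\<Sum>i\<in>S. \<Sum>j\<in>S. b i * b j * l2_inner M (v i) (v j))"
  proof -
    have "l2_inner M g (v i) = (\<Sum>j\<in>S. b j * l2_inner M (v i) (v j))" for i
      using gh[OF v[of i]] by (simp add: l2_inner_commute[of M g])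
    then show ?thesis by (simp add: G_def gh[OF g] sum_distrib_left mult.assoc)
  qed
  moreover have "s = (\<Sum>i\<in>S. \<Sum>j\<in>S. b i * b j * of_bool (i = j))"
    using S by (simp add: s_def power2_eq_square if_distrib of_bool_def sum.delta cong: if_cong)
  ultimately show "0 \<le> (\<Sum>i\<in>S. \<Sum>j\<in>S. b i * b j * (of_bool (i = j) - l2_inner M (v i) (v j)))"
    by (simp add: right_diff_distrib sum_subtractf)
qed

section \<open>Dilation to an orthonormal basis\<close>

text \<open>Build a decreasing sequence of sets with strictly decreasing finite measures; the
  differences of consecutive sets are disjoint and have positive measure.\<close>

lemma continuous_measure_disjoint_sequence:
  assumes M: "continuous_measure M" and pos: "0 < emeasure M (space M)"
  obtains F :: "nat \<Rightarrow> 'a set" where "\<And>n. F n \<in> sets M" "\<And>n. 0 < emeasure M (F n)"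
    "\<And>n. emeasure M (F n) < \<infinity>" "disjoint_family F"
proof -
  obtain A0 where A0: "A0 \<in> sets M" "0 < emeasure M A0" "emeasure M A0 < \<infinity>"
    by (rule continuous_measure_small_subset[OF M sets.top pos zero_less_one])
  have "\<exists>A. \<forall>n. (A n \<in> sets M \<and> 0 < emeasure M (A n) \<and> emeasure M (A n) < \<infinity>) \<and>
      (A (Suc n) \<subseteq> A n \<and> emeasure M (A (Suc n)) < emeasure M (A n))"
  proof (rule dependent_nat_choice)
    show "\<exists>A. A \<in> sets M \<and> 0 < emeasure M A \<and> emeasure M A < \<infinity>" using A0 by blast
    fix A assume A: "A \<in> sets M \<and> 0 < emeasure M A \<and> emeasure M A < \<infinity>"
    then obtain B where "B \<in> sets M" "B \<subseteq> A" "0 < emeasure M B" "emeasure M B < emeasure M A"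
      using M unfolding continuous_measure_def by blast
    then show "\<exists>B. (B \<in> sets M \<and> 0 < emeasure M B \<and> emeasure M B < \<infinity>) \<and>
        (B \<subseteq> A \<and> emeasure M B < emeasure M A)"
      using A by (intro exI[of _ B]) (auto intro: order_less_trans)
  qed
  then obtain A where A: "\<And>n. A n \<in> sets M" "\<And>n. emeasure M (A n) < \<infinity>"
      "\<And>n. A (Suc n) \<subseteq> A n" "\<And>n. emeasure M (A (Suc n)) < emeasure M (A n)"
    by auto
  have dec: "A n \<subseteq> A m" if "m \<le> n" for m n using A(3) that by (rule lift_Suc_antimono_le)
  show ?thesis
  proof
    fix n
    show "A n - A (Suc n) \<in> sets M" using A by blast
    show "emeasure M (A n - A (Suc n)) < \<infinity>"
      using emeasure_mono[OF Diff_subset A(1)] A(2)[of n] by (rule order_le_less_trans)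
    have "emeasure M (A n) = emeasure M (A n - A (Suc n)) + emeasure M (A (Suc n))"
      using plus_emeasure[OF sets.Diff[OF A(1) A(1)] A(1), of n "Suc n" "Suc n"] A(3)[of n]
      by (simp add: Un_absorb2 inf_commute[of "A n - A (Suc n)"])
    then show "0 < emeasure M (A n - A (Suc n))"
      using A(4)[of n] by (auto simp: zero_less_iff_neq_zero)
  next
    have "(A m - A (Suc m)) \<inter> (A n - A (Suc n)) = {}" if "m < n" for m n
      using dec[of "Suc m" n] that by auto
    then show "disjoint_family (\<lambda>n. A n - A (Suc n))"
      unfolding disjoint_family_on_def by (metis Int_commute nat_neq_iff)
  qed
qed

text \<open>The reserve \<open>r\<close> guarantees that infinitely many elements of a maximal set
  lie outside the range of \<open>a\<close>, so that they fill all even positions while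
  \<open>a\<close> fills the odd ones.\<close>

lemma orthonormal_basis_extending:
  fixes a r :: "nat \<Rightarrow> 'a \<Rightarrow> real"
  assumes sep: "L2_separable M"
    and L2: "\<And>n. a n \<in> L2 M" "\<And>n. r n \<in> L2 M"
    and aa: "\<And>i j. l2_inner M (a i) (a j) = (if i = j then 1 else 0)"
    and rr: "\<And>i j. l2_inner M (r i) (r j) = (if i = j then 1 else 0)"
    and ar: "\<And>i j. l2_inner M (a i) (r j) = 0"
  obtains u where "orthonormal_basis M u" "\<And>n. u (2 * n + 1) = a n"
proof -
  have inj_a: "inj a" and inj_r: "inj r"
    using aa rr by (metis (no_types, lifting) injI zero_neq_one)+
  have disj: "a i \<noteq> r j" for i j
    using ar[of i j] rr[of j j] by auto
  have "orthonormal_set M (range a \<union> range r)"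
    unfolding orthonormal_set_def
    using L2 aa rr ar disj inj_a inj_r ar[unfolded l2_inner_commute[of M "a _"]]
    by (auto simp: inj_eq disj[symmetric])
  then obtain S where S: "range a \<union> range r \<subseteq> S" "orthonormal_set M S"
    and total: "\<And>f. f \<in> L2 M \<Longrightarrow> (\<And>g. g \<in> S \<Longrightarrow> l2_inner M f g = 0) \<Longrightarrow> AE x in M. f x = 0"
    by (rule orthonormal_set_extend) blast
  define R where "R = S - range a"
  have "range r \<subseteq> R" using S(1) by (auto simp: R_def disj[symmetric])
  then have "infinite R" using range_inj_infinite[OF inj_r] by (meson finite_subset)
  moreover have "countable R"
    using countable_orthonormal_set[OF sep S(2)] by (simp add: R_def)
  ultimately have b: "bij_betw (from_nat_into R) UNIV R" by (intro bij_betw_from_nat_into)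
  \<comment> \<open>Indices start at 0, so the odd positions here are the even-numbered members of a
    sequence counted from 1.\<close>
  define u where "u k = (if even k then from_nat_into R (k div 2) else a (k div 2))" for k
  have u: "u (2 * n) = from_nat_into R n" "u (2 * n + 1) = a n" for n by (simp_all add: u_def)
  have R: "from_nat_into R n \<in> R" for n using b by (auto simp: bij_betw_def)
  have uS: "u k \<in> S" for k
    using R[of "k div 2"] S(1) by (auto simp: u_def R_def)
  have "inj u"
  proof (rule injI)
    fix k l assume eq: "u k = u l"
    have "from_nat_into R i \<noteq> a j" for i j using R[of i] by (auto simp: R_def)
    then have par: "even k \<longleftrightarrow> even l" using eq unfolding u_def by (metis (full_types))
    moreover have "k div 2 = l div 2"
      using eq par inj_a bij_betw_imp_inj_on[OF b] by (auto simp: u_def inj_eq split: if_splits)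
    ultimately show "k = l" by (metis even_two_times_div_two odd_two_times_div_two_succ)
  qed
  have "orthonormal_basis M u"
    unfolding orthonormal_basis_def
  proof (intro conjI allI ballI impI)
    show "u k \<in> L2 M" for k using uS S(2) by (auto simp: orthonormal_set_def)
    show "l2_inner M (u j) (u k) = (if j = k then 1 else 0)" for j k
      using uS S(2) \<open>inj u\<close> by (auto simp: orthonormal_set_def inj_eq)
    fix f assume f: "f \<in> L2 M" and z: "\<forall>k. l2_inner M f (u k) = 0"
    have "l2_inner M f g = 0" if "g \<in> S" for g
    proof (cases "g \<in> range a")
      case True
      then show ?thesis using z u(2) by (metis rangeE)
    next
      case False
      then have "g \<in> R" using that by (simp add: R_def)
      then obtain n where "g = from_nat_into R n" using b by (auto simp: bij_betw_def)
      then show ?thesis using z u(1) by metis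
    qed
    with f show "AE x in M. f x = 0" by (rule total)
  qed
  then show ?thesis using u(2) by (rule that)
qed

theorem theorem1p2:
  fixes M :: "'a measure"
  assumes "sigma_finite_measure M"
    and "continuous_measure M"
    and "L2_separable M"
  shows "(\<exists>v. conditions_123 M v) \<and>
         (0 < emeasure M (space M) \<longrightarrow>
           (\<exists>E u. E \<in> sets M \<and> 0 < emeasure M E \<and> emeasure M E < \<infinity> \<and>
              orthonormal_basis M u \<and>
              conditions_123 (restrict_space M E) (\<lambda>n. u (2 * n + 1))))"
proof (intro conjI impI)
  note M = assms(2) and sep = assms(3)
  show "\<exists>v. conditions_123 M v"
    by (rule conditions_123_exists[OF M sep]) blast
  assume "0 < emeasure M (space M)"
  then obtain F :: "nat \<Rightarrow> 'a set" where F: "\<And>n. F n \<in> sets M" "\<And>n. 0 < emeasure M (F n)"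
      "\<And>n. emeasure M (F n) < \<infinity>" and disj: "disjoint_family F"
    by (rule continuous_measure_disjoint_sequence[OF M]) blast
  define E where "E = F 0"
  define N where "N = restrict_space M E"
  have E: "E \<in> sets M" by (simp add: E_def F)
  obtain v where "conditions_123 N v"
    unfolding N_def
    by (rule conditions_123_exists[OF continuous_measure_restrict_space[OF M E]
          L2_separable_restrict_space[OF sep E]])
  then obtain w where w: "conditions_123 N w"
    and bessel: "\<And>f S. f \<in> L2 N \<Longrightarrow> finite S \<Longrightarrow> (\<Sum>n\<in>S. (l2_inner N f (w n))\<^sup>2) \<le> l2_inner N f f"
    by (rule conditions_123_unit_bound) blast
  have wL: "w n \<in> L2 N" for n using w by (simp add: conditions_123_def)
  obtain L :: "nat \<Rightarrow> nat \<Rightarrow> real"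
    where L: "\<And>i j. (\<Sum>k\<le>min i j. L i k * L j k) = of_bool (i = j) - l2_inner N (w i) (w j)"
    using psd_cholesky[OF psd_one_minus_gram[OF wL bessel]] by blast
  \<comment> \<open>The support of \<open>e 0\<close> is \<open>E\<close>. Off \<open>E\<close>, the
    odd indices carry the correction terms, and the even indices from 2 on form the reserve for the
    basis.\<close>
  define e :: "nat \<Rightarrow> 'a \<Rightarrow> real"
    where "e n = (\<lambda>x. 1 / sqrt (measure M (F n)) * indicator (F n) x)" for n
  have eL: "e n \<in> L2 M" for n
    unfolding e_def by (intro L2_scale L2_indicator F)
  have F_disj: "F i \<inter> F j = {}" if "i \<noteq> j" for i j
    using disj that by (auto simp: disjoint_family_on_def)
  have F_eq: "F i = F j \<longleftrightarrow> i = j" for i j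
    using F_disj[of i j] F(2)[of i] by (cases "i = j") auto
  have ee: "l2_inner M (e i) (e j) = (if i = j then 1 else 0)" for i j
  proof -
    have "F i = F j \<or> F i \<inter> F j = {}" using F_disj[of i j] by blast
    then show ?thesis
      unfolding e_def using l2_inner_normalized_indicators[OF F F(1), of i j] by (simp add: F_eq)
  qed
  have e_E: "e k x = 0" if "x \<in> E" "0 < k" for k x
    using F_disj[of 0 k] that by (auto simp: e_def E_def indicator_def)
  \<comment> \<open>Extension of \<open>w n\<close> by zero, which preserves inner products.\<close>
  define V where "V n = (\<lambda>x. indicator E x * w n x)" for n
  have V: "V n \<in> L2 M" for n
    using wL unfolding V_def N_def L2_restrict_space_iff[OF E] .
  have VV: "l2_inner M (V i) (V j) = l2_inner N (w i) (w j)" for i j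
    unfolding V_def N_def by (rule l2_inner_restrict_space[OF E, symmetric])
  have Ve: "l2_inner M (V i) (e k) = 0" if "0 < k" for i k
  proof -
    have "V i x * e k x = 0" for x using e_E that by (auto simp: V_def indicator_def)
    then show ?thesis unfolding l2_inner_def by (simp only: Bochner_Integration.integral_zero)
  qed
  \<comment> \<open>Row \<open>n\<close> of the Cholesky factor as coefficients: the Gram matrix of
    \<open>Y\<close> is then the identity minus that of \<open>w\<close>, and \<open>Y n\<close>
    vanishes on \<open>E\<close>.\<close>
  define Y where "Y n = (\<lambda>x. \<Sum>k\<le>n. L n k * e (2 * k + 1) x)" for n
  have Y: "Y n \<in> L2 M" for n unfolding Y_def by (intro L2_sum L2_scale eL)
  have inner_Y: "l2_inner M h (Y n) = (\<Sum>k\<le>n. L n k * l2_inner M h (e (2 * k + 1)))"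
    if "h \<in> L2 M" for h n
    unfolding Y_def using that by (subst l2_inner_sum_right) (auto simp: l2_inner_scale_right eL L2_scale)
  have Ye: "l2_inner M (Y n) (e (2 * k + 1)) = (if k \<le> n then L n k else 0)" for k n
    unfolding l2_inner_commute[of M "Y n"]
    by (simp add: inner_Y eL ee if_distrib[of "\<lambda>t. _ * t"] sum.delta cong: if_cong)
  have YY: "l2_inner M (Y i) (Y j) = (\<Sum>k\<le>min i j. L i k * L j k)" for i j
  proof -
    have "l2_inner M (Y i) (Y j) = (\<Sum>k\<le>j. L j k * (if k \<le> i then L i k else 0))"
      unfolding inner_Y[OF Y] Ye ..
    also have "\<dots> = (\<Sum>k\<le>min i j. L i k * L j k)"
      by (intro sum.mono_neutral_cong_right) auto
    finally show ?thesis .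
  qed
  have VY: "l2_inner M (V i) (Y j) = 0" for i j
    by (simp add: inner_Y V Ve)
  \<comment> \<open>\<open>V\<close> and \<open>Y\<close> are mutually orthogonal, so their Gram
    matrices add up to the identity, while \<open>a n\<close> still equals \<open>w n\<close> on
    \<open>E\<close>.\<close>
  define a where "a n = (\<lambda>x. V n x + Y n x)" for n
  obtain u where u: "orthonormal_basis M u" and u_a: "\<And>n. u (2 * n + 1) = a n"
  proof (rule orthonormal_basis_extending[OF sep, of a "\<lambda>n. e (2 * n + 2)"])
    show "a n \<in> L2 M" for n unfolding a_def by (intro L2_add V Y)
    show "l2_inner M (a i) (a j) = (if i = j then 1 else 0)" for i j
      by (simp add: a_def l2_inner_add_left l2_inner_add_right L2_add V Y VV YY VY L
          l2_inner_commute[of M "Y i" "V j"])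
    show "l2_inner M (a i) (e (2 * j + 2)) = 0" for i j
    proof -
      have "l2_inner M (e (2 * j + 2)) (Y i) = 0"
      proof -
        have "2 * j + 2 \<noteq> 2 * k + 1" for k by presburger
        then show ?thesis unfolding inner_Y[OF eL] ee by simp
      qed
      then show ?thesis
        by (simp add: a_def l2_inner_add_left V Y eL Ve l2_inner_commute[of M "Y i"])
    qed
  qed (auto simp: eL ee)
  have "conditions_123 N (\<lambda>n. u (2 * n + 1)) \<longleftrightarrow> conditions_123 N w"
  proof (rule conditions_123_cong)
    fix n x assume "x \<in> space N"
    then have "x \<in> E" by (simp add: N_def space_restrict_space)
    then show "u (2 * n + 1) x = w n x"
      unfolding u_a by (simp add: a_def V_def Y_def e_E)
  qed
  then show "\<exists>E u. E \<in> sets M \<and> 0 < emeasure M E \<and> emeasure M E < \<infinity> \<and>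
      orthonormal_basis M u \<and> conditions_123 (restrict_space M E) (\<lambda>n. u (2 * n + 1))"
    using u w F[of 0] by (intro exI[of _ E] exI[of _ u]) (simp add: N_def E_def)
qed

end
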